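(* Let $X$ be any real or complex separable infinite-dimensional Banach space and let $N\in\mathbb{N}$. There exists a bounded linear operator $T:X\to X$ such that the $N$-fold direct sum $T_{(N)}=T\oplus\cdots\oplus T$ on $X^N$ satisfies $\mathrm{Rec}(T_{(N)})=X^N$ (in particular $T_{(N)}$ is recurrent), while the $(N+1)$-fold direct sum $T_{(N+1)}$ on $X^{N+1}$ is not recurrent. In particular (taking $N=1$), there exists a recurrent operator $T$ on $X$ such that $T\oplus T$ is not recurrent.
   Context: For an operator $S$ on a space $Y$, a vector $y$ is recurrent if $y\in\overline{\{S^ny:n\geq1\}}$; $\mathrm{Rec}(S)$ denotes the set of recurrent vectors, and $S$ is recurrent if $\mathrm{Rec}(S)$ is dense in $Y$. $T_{(N)}(x_1,\dots,x_N)=(Tx_1,\dots,Tx_N)$ on the direct sum $X^N$. *)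

theory Defs
  imports "HOL-Analysis.Analysis"
begin

text \<open>The N-fold direct sum X^N is represented by functions nat => 'a, of which only the
  coordinates i < N matter; its topology is the (finite) product topology, i.e. given by
  the max-metric over the coordinates i < N. T_(N) acts coordinatewise, so
  (T_(N))^n x = (\<lambda>i. (T^^n) (x i)).\<close>

definition recurrent_vec :: "('a::metric_space \<Rightarrow> 'a) \<Rightarrow> nat \<Rightarrow> (nat \<Rightarrow> 'a) \<Rightarrow> bool" where
  "recurrent_vec T N x \<longleftrightarrow>
     (\<forall>e>0. \<exists>n\<ge>1. \<forall>i<N. dist ((T ^^ n) (x i)) (x i) < e)"

definition all_recurrent_sum :: "('a::metric_space \<Rightarrow> 'a) \<Rightarrow> nat \<Rightarrow> bool" where
  "all_recurrent_sum T N \<longleftrightarrow> (\<forall>x. recurrent_vec T N x)"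

definition recurrent_sum :: "('a::metric_space \<Rightarrow> 'a) \<Rightarrow> nat \<Rightarrow> bool" where
  "recurrent_sum T N \<longleftrightarrow>
     (\<forall>x. \<forall>e>0. \<exists>y. recurrent_vec T N y \<and> (\<forall>i<N. dist (y i) (x i) < e))"

definition separable_space :: "'a::metric_space itself \<Rightarrow> bool" where
  "separable_space _ \<longleftrightarrow> (\<exists>D::'a set. countable D \<and> closure D = UNIV)"

definition infinite_dimensional :: "'a::real_vector itself \<Rightarrow> bool" where
  "infinite_dimensional _ \<longleftrightarrow> \<not> (\<exists>B::'a set. finite B \<and> span B = UNIV)"

text \<open>A complex structure on a real Banach space: multiplication by i, turning the
  space into a complex Banach space with the same norm via (a + ib)x = a x + b J x.\<close>
definition complex_structure :: "('a::real_normed_vector \<Rightarrow> 'a) \<Rightarrow> bool" where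
  "complex_structure J \<longleftrightarrow> bounded_linear J \<and> (\<forall>x. J (J x) = - x) \<and>
     (\<forall>t x. norm (cos t *\<^sub>R x + sin t *\<^sub>R J x) = norm x)"

end

theory Submission
  imports Defs
begin

text \<open>
  Fix a biorthogonal sequence of blocks \<open>B k\<close> (embeddings of the plane \<open>\<complex>\<close>) and \<open>A k\<close>
  (coordinates in \<open>\<complex>\<close>). The operator \<open>T\<close> fixes the first \<open>N + 1\<close> coordinates, rotates the
  \<open>k\<close>-th of the remaining blocks by a root of unity of order \<open>m (k + 1)\<close>, where
  \<open>m k dvd m (k + 1)\<close> and \<open>m\<close> grows fast, and adds to that block \<open>g k x / m k\<close>, where \<open>g k\<close> is
  a linear form in the first \<open>N + 1\<close> coordinates. After \<open>m k\<close> steps all blocks before the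
  \<open>k\<close>-th are back in place, those after it have hardly moved, and the \<open>k\<close>-th has moved
  essentially by \<open>g k x\<close>. The forms \<open>g k\<close> run through a dense set; as \<open>N\<close> vectors have a common
  nonzero annihilator among the forms in \<open>N + 1\<close> variables, every \<open>N\<close>-tuple is recurrent.
  For an \<open>(N + 1)\<close>-tuple close to the coordinate vectors some \<open>g k (x i)\<close> is large for each
  \<open>k\<close>. Given \<open>n \<ge> 1\<close>, take \<open>k\<close> with \<open>m k dvd n\<close> and \<open>\<not> m (k + 1) dvd n\<close>: then the
  \<open>k\<close>-th block of \<open>T\<^sup>n (x i) - x i\<close> is bounded below, and the earlier blocks vanish, so a
  functional that annihilates only the later blocks detects it. Hence a triangular system of
  functionals with uniform bounds is enough, which Hahn--Banach provides.
\<close>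

section \<open>Functionals and linear systems\<close>

text \<open>One-dimensional step of Hahn-Banach. By the triangle inequality each lower bound
  \<open>t - norm (y - z)\<close> for the value at \<open>z\<close> lies below each upper bound
  \<open>norm (y' + z) - t'\<close>, so the supremum of the lower bounds serves as
  \<open>c\<close>.\<close>

lemma subspace_dominated_extend:
  fixes G :: "('a::real_normed_vector \<times> real) set"
  assumes G: "subspace G" and dom: "\<And>y t. (y, t) \<in> G \<Longrightarrow> t \<le> norm y"
  obtains G' c where "subspace G'" "\<And>y t. (y, t) \<in> G' \<Longrightarrow> t \<le> norm y"
    "G \<subseteq> G'" "(z, c) \<in> G'"
proof -
  have sep: "t - norm (y - z) \<le> norm (y' + z) - t'" if "(y, t) \<in> G" "(y', t') \<in> G" for y t y' t'
  proof -
    have "t + t' \<le> norm (y + y')"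
      using dom subspace_add[OF G that] by simp
    also have "\<dots> = norm ((y - z) + (y' + z))"
      by simp
    also have "\<dots> \<le> norm (y - z) + norm (y' + z)"
      by (rule norm_triangle_ineq)
    finally show ?thesis by simp
  qed
  have zero: "(0, 0) \<in> G"
    using subspace_0[OF G] by (simp add: zero_prod_def)
  define c where "c = (SUP (y, t) \<in> G. t - norm (y - z))"
  have bdd: "bdd_above ((\<lambda>(y, t). t - norm (y - z)) ` G)"
    using sep[OF _ zero] by (intro bdd_aboveI[of _ "norm z"]) auto
  have lo: "t - norm (y - z) \<le> c" if "(y, t) \<in> G" for y t
    unfolding c_def using cSUP_upper[OF that bdd] by simp
  have hi: "c \<le> norm (y + z) - t" if "(y, t) \<in> G" for y t
    unfolding c_def using zero sep[OF _ that] by (intro cSUP_least) auto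
  let ?G' = "{p + q | p q. p \<in> G \<and> q \<in> span {(z, c)}}"
  have "t \<le> norm y" if yt: "(y, t) \<in> ?G'" for y t
  proof -
    obtain u v s where uv: "(u, v) \<in> G" and y: "y = u + s *\<^sub>R z" and t: "t = v + s * c"
      using yt unfolding span_singleton by auto
    have uv': "(inverse k *\<^sub>R u, inverse k * v) \<in> G" for k
      using subspace_scale[OF G uv, of "inverse k"] by simp
    \<comment> \<open>Dividing by \<open>\<bar>s\<bar>\<close> reduces to coefficient 1 or -1 of
      \<open>z\<close>, where \<open>hi\<close> or \<open>lo\<close> applies.\<close>
    consider "s = 0" | "s > 0" | "s < 0" by linarith
    then show ?thesis
    proof cases
      case 1
      then show ?thesis using dom[OF uv] y t by simp
    next
      case 2
      have "s * c \<le> s * (norm (inverse s *\<^sub>R u + z) - inverse s * v)"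
        using hi[OF uv'[of s]] 2 by (intro mult_left_mono) auto
      also have "\<dots> = norm (s *\<^sub>R (inverse s *\<^sub>R u + z)) - v"
        using 2 by (simp add: right_diff_distrib)
      also have "s *\<^sub>R (inverse s *\<^sub>R u + z) = y"
        using 2 y by (simp add: scaleR_add_right)
      finally show ?thesis using t by simp
    next
      case 3
      define k where "k = - s"
      have k: "k > 0" "s = - k" using 3 by (auto simp: k_def)
      have "k * (inverse k * v - norm (inverse k *\<^sub>R u - z)) \<le> k * c"
        using lo[OF uv'[of k]] k by (intro mult_left_mono) auto
      moreover have "k * (inverse k * v - norm (inverse k *\<^sub>R u - z)) = v - norm (k *\<^sub>R (inverse k *\<^sub>R u - z))"
        using k by (simp add: right_diff_distrib)
      moreover have "k *\<^sub>R (inverse k *\<^sub>R u - z) = y"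
        using k y by (simp add: scaleR_diff_right)
      ultimately show ?thesis using t k by simp
    qed
  qed
  moreover have "subspace ?G'"
    by (intro subspace_sums G subspace_span)
  moreover have "G \<subseteq> ?G'"
  proof
    fix p assume "p \<in> G"
    then have "p + 0 \<in> ?G'"
      by (intro CollectI exI conjI) (rule refl, assumption, rule span_zero)
    then show "p \<in> ?G'" by simp
  qed
  moreover have "(z, c) \<in> ?G'"
  proof -
    have "0 + (z, c) \<in> ?G'"
      by (intro CollectI exI conjI) (rule refl, rule subspace_0[OF G], simp add: span_base)
    then show ?thesis by simp
  qed
  ultimately show thesis by (intro that)
qed

text \<open>Partial functionals are represented by their graphs: a subspace on which the second component
  is dominated by the norm of the first is automatically single-valued.\<close>

lemma ex_norming_functional:
  fixes x :: "'a::real_normed_vector"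
  assumes "norm x = 1"
  obtains f :: "'a \<Rightarrow> real" where "bounded_linear f" "\<And>y. \<bar>f y\<bar> \<le> norm y" "f x = 1"
proof -
  define \<G> where "\<G> = {G :: ('a \<times> real) set. subspace G \<and> (\<forall>(y, t) \<in> G. t \<le> norm y) \<and> (x, 1) \<in> G}"
  have "t \<le> norm y" if "(y, t) \<in> span {(x, 1)}" for y t
    using that assms unfolding span_singleton by auto
  then have ne: "span {(x, 1)} \<in> \<G>"
    by (auto simp: \<G>_def span_base)
  have "\<exists>M\<in>\<G>. \<forall>Y\<in>\<G>. M \<subseteq> Y \<longrightarrow> Y = M"
  proof (rule subset_Zorn_nonempty)
    show "\<G> \<noteq> {}" using ne by auto
    fix C assume C: "C \<noteq> {}" "subset.chain \<G> C"
    have sub: "C \<subseteq> \<G>" and lin: "\<And>Y Z. Y \<in> C \<Longrightarrow> Z \<in> C \<Longrightarrow> Y \<subseteq> Z \<or> Z \<subseteq> Y"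
      using C(2) by (auto simp: subset_chain_def)
    have "subspace (\<Union> C)"
      unfolding subspace_def
    proof (intro conjI ballI allI)
      show "0 \<in> \<Union> C"
      proof -
        obtain Y where "Y \<in> C" using C(1) by auto
        then show ?thesis using sub subspace_0[of Y] unfolding \<G>_def by blast
      qed
      fix p q assume "p \<in> \<Union> C" "q \<in> \<Union> C"
      then obtain Y where "Y \<in> C" "p \<in> Y" "q \<in> Y" using lin by blast
      then show "p + q \<in> \<Union> C"
        using sub subspace_add[of Y p q] unfolding \<G>_def by blast
    next
      fix r p assume "p \<in> \<Union> C"
      then obtain Y where "Y \<in> C" "p \<in> Y" by blast
      then show "r *\<^sub>R p \<in> \<Union> C"
        using sub subspace_scale[of Y p r] unfolding \<G>_def by blast
    qed
    then show "\<Union> C \<in> \<G>" using C(1) sub unfolding \<G>_def by fastforce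
  qed
  then obtain M where M: "M \<in> \<G>" and max: "\<And>Y. Y \<in> \<G> \<Longrightarrow> M \<subseteq> Y \<Longrightarrow> Y = M" by blast
  have sM: "subspace M" and dom: "\<And>y t. (y, t) \<in> M \<Longrightarrow> t \<le> norm y" and xM: "(x, 1) \<in> M"
    using M by (auto simp: \<G>_def)
  have total: "\<exists>t. (z, t) \<in> M" for z
  proof -
    obtain G' c where G': "subspace G'" "\<And>y t. (y, t) \<in> G' \<Longrightarrow> t \<le> norm y" "M \<subseteq> G'" "(z, c) \<in> G'"
      using subspace_dominated_extend[OF sM dom] by metis
    then have "G' \<in> \<G>" using xM by (auto simp: \<G>_def)
    then show ?thesis using max G' by blast
  qed
  have uniq: "s = t" if "(z, s) \<in> M" "(z, t) \<in> M" for z s t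
    using subspace_diff[OF sM that] subspace_diff[OF sM that(2,1)] dom[of 0 "s - t"] dom[of 0 "t - s"]
    by simp
  define f where "f z = (SOME t. (z, t) \<in> M)" for z
  have f: "(z, f z) \<in> M" for z
    unfolding f_def using total by (rule someI_ex)
  have f_eq: "f z = t" if "(z, t) \<in> M" for z t
    using uniq f that by blast
  have add: "f (y + z) = f y + f z" for y z
    using subspace_add[OF sM f f, of y z] by (intro f_eq) simp
  have scale: "f (r *\<^sub>R z) = r *\<^sub>R f z" for r z
    using subspace_scale[OF sM f, of r z] by (intro f_eq) simp
  have le: "\<bar>f y\<bar> \<le> norm y" for y
    using dom[OF f, of y] dom[OF f, of "- y"] scale[of "-1" y] by simp
  show thesis
  proof
    show "bounded_linear f"
      by (rule bounded_linear_intro[where K = 1]) (auto simp: add scale le)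
    show "f x = 1" by (rule f_eq[OF xM])
  qed (rule le)
qed

section \<open>Common kernels and underdetermined systems\<close>

text \<open>The kernel has codimension at most one in \<open>S\<close>: a finite spanning set of it,
  together with one vector of \<open>S\<close> outside it, would span \<open>S\<close>.\<close>

lemma not_finitely_spanned_kernel:
  fixes f :: "'a::real_vector \<Rightarrow> real"
  assumes S: "subspace S" "\<nexists>B. finite B \<and> span B = S" and f: "linear f"
  shows "subspace (S \<inter> {x. f x = 0})" "\<nexists>B. finite B \<and> span B = S \<inter> {x. f x = 0}"
proof -
  show sub: "subspace (S \<inter> {x. f x = 0})"
    by (intro subspace_inter S linear_subspace_kernel f)
  show "\<nexists>B. finite B \<and> span B = S \<inter> {x. f x = 0}"
  proof (cases "\<exists>v\<in>S. f v \<noteq> 0")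
    case False
    then have "S \<inter> {x. f x = 0} = S" by auto
    then show ?thesis using S by simp
  next
    case True
    then obtain v where v: "v \<in> S" "f v \<noteq> 0" by auto
    show ?thesis
    proof
      assume "\<exists>B. finite B \<and> span B = S \<inter> {x. f x = 0}"
      then obtain B where B: "finite B" "span B = S \<inter> {x. f x = 0}" by auto
      have "span (insert v B) = S"
      proof
        show "span (insert v B) \<subseteq> S"
          using B v span_superset[of B] S by (intro span_minimal) auto
        show "S \<subseteq> span (insert v B)"
        proof
          fix x assume x: "x \<in> S"
          have "x - (f x / f v) *\<^sub>R v \<in> span B"
            unfolding B using x v S
            by (auto simp: linear_diff[OF f] linear_scale[OF f] intro!: subspace_diff subspace_scale)
          then show "x \<in> span (insert v B)"
            unfolding span_insert by blast
        qed
      qed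
      then show False using S B by auto
    qed
  qed
qed

lemma ex_unit_in_kernels:
  fixes F :: "('a::real_normed_vector \<Rightarrow> real) set"
  assumes "infinite_dimensional TYPE('a)" "finite F" "\<And>f. f \<in> F \<Longrightarrow> linear f"
  obtains x :: 'a where "norm x = 1" "\<And>f. f \<in> F \<Longrightarrow> f x = 0"
proof -
  have "subspace {x. \<forall>f\<in>F. f x = 0} \<and> (\<nexists>B. finite B \<and> span B = {x. \<forall>f\<in>F. f x = 0})"
    using assms(2,3)
  proof (induction F)
    case empty
    then show ?case using assms(1) by (simp add: infinite_dimensional_def)
  next
    case (insert f F)
    have eq: "{x. \<forall>g\<in>insert f F. g x = 0} = {x. \<forall>g\<in>F. g x = 0} \<inter> {x. f x = 0}" by auto
    show ?case
      unfolding eq using insert by (intro conjI not_finitely_spanned_kernel) auto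
  qed
  moreover have "span {} = {0::'a}" by simp
  ultimately have "{x. \<forall>f\<in>F. f x = 0} \<noteq> {0}" by (metis finite.emptyI)
  moreover have "0 \<in> {x. \<forall>f\<in>F. f x = 0}"
    using assms(3) linear_0 by auto
  ultimately obtain x where x: "x \<noteq> 0" "\<forall>f\<in>F. f x = 0" by blast
  show thesis
    by (rule that[of "x /\<^sub>R norm x"]) (use x assms(3) in \<open>auto simp: linear_scale\<close>)
qed

text \<open>Gaussian elimination by induction on the number of equations: an unknown
  \<open>l\<close> occurring in the last equation is eliminated from the others.\<close>

lemma homogeneous_system_nontrivial:
  fixes c :: "nat \<Rightarrow> 'i \<Rightarrow> 'f::field"
  assumes "finite I" "n < card I"
  obtains a where "\<exists>j\<in>I. a j \<noteq> 0" "\<And>i. i < n \<Longrightarrow> (\<Sum>j\<in>I. a j * c i j) = 0"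
  using assms
proof (induction n arbitrary: I c thesis)
  case 0
  then obtain j where "j \<in> I" by fastforce
  then show ?case using 0(1)[of "\<lambda>_. 1"] by auto
next
  case (Suc n)
  show ?case
  proof (cases "\<exists>j\<in>I. c n j \<noteq> 0")
    case False
    obtain a where a: "\<exists>j\<in>I. a j \<noteq> 0" "\<And>i. i < n \<Longrightarrow> (\<Sum>j\<in>I. a j * c i j) = 0"
      using Suc.IH[of I c] Suc.prems by auto
    show ?thesis
      using a False by (intro Suc.prems(1)[of a]) (auto simp: less_Suc_eq)
  next
    case True
    then obtain l where l: "l \<in> I" "c n l \<noteq> 0" by auto
    define J where "J = I - {l}"
    have J: "finite J" "n < card J" "I = insert l J" "l \<notin> J"
      using Suc.prems l by (auto simp: J_def)
    obtain a where a: "\<exists>j\<in>J. a j \<noteq> 0"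
      and sol: "\<And>i. i < n \<Longrightarrow> (\<Sum>j\<in>J. a j * (c i j - c i l * c n j / c n l)) = 0"
      using Suc.IH[of J "\<lambda>i j. c i j - c i l * c n j / c n l"] J by blast
    define s where "s = (\<Sum>j\<in>J. a j * c n j)"
    \<comment> \<open>The value at \<open>l\<close> is the one that solves the last equation;
      substituting it turns each other equation into its reduced form.\<close>
    define b where "b = a(l := - s / c n l)"
    have "(\<Sum>j\<in>I. b j * c i j) = (\<Sum>j\<in>J. a j * c i j) - s / c n l * c i l" for i
    proof -
      have "(\<Sum>j\<in>J. b j * c i j) = (\<Sum>j\<in>J. a j * c i j)"
        using J by (intro sum.cong) (auto simp: b_def)
      then show ?thesis using J by (simp add: b_def)
    qed
    moreover have "(\<Sum>j\<in>J. a j * (c i j - c i l * c n j / c n l)) = (\<Sum>j\<in>J. a j * c i j) - s / c n l * c i l" for i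
      unfolding s_def sum_divide_distrib sum_distrib_right
      by (simp add: right_diff_distrib sum_subtractf mult_ac)
    ultimately have "(\<Sum>j\<in>I. b j * c i j) = 0" if "i < Suc n" for i
      using that sol[of i] l by (cases "i = n") (auto simp: s_def)
    moreover have "\<exists>j\<in>I. b j \<noteq> 0"
      using a J by (auto simp: b_def)
    ultimately show ?thesis by (rule Suc.prems(1)[rotated])
  qed
qed

section \<open>Coefficients of the forms, and roots of unity\<close>

text \<open>Supplies the forms \<open>g k\<close>. Recurrence needs each nonzero form approximated,
  up to a positive factor, at arbitrarily late \<open>k\<close>; the lower bound serves
  non-recurrence and the upper bound convergence.\<close>

lemma ex_dense_repeating_coefficients:
  fixes N :: nat
  obtains a :: "nat \<Rightarrow> nat \<Rightarrow> complex" where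
    "\<And>k. \<exists>j\<le>N. 1 \<le> norm (a k j)" "\<And>k j. j \<le> N \<Longrightarrow> norm (a k j) \<le> 2"
    "\<And>c. (\<exists>j\<le>N. c j \<noteq> 0) \<Longrightarrow>
      \<exists>s>0. \<forall>e>0. \<forall>K. \<exists>k\<ge>K. \<forall>j\<le>N. norm (a k j - of_real s * c j) < e"
proof -
  obtain D :: "complex set" where D: "countable D" "\<And>U. open U \<Longrightarrow> U \<noteq> {} \<Longrightarrow> \<exists>d\<in>D. d \<in> U"
    using countable_dense_setE by blast
  have "D \<noteq> {}" using D(2)[of UNIV] by auto
  then obtain q :: "nat \<Rightarrow> complex" where q: "range q = D"
    using D(1) by (metis range_from_nat_into)
  have dense: "\<exists>i. norm (q i - z) < e" if "e > 0" for e z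
    using D(2)[of "ball z e"] that q by (auto simp: dist_norm norm_minus_commute)
  \<comment> \<open>The second component is a dummy: it makes each list of indices into
    \<open>q\<close> occur for infinitely many \<open>k\<close>.\<close>
  define p where "p k = (from_nat k :: nat list \<times> nat)" for k
  define ok where "ok u \<longleftrightarrow> (\<exists>j\<le>N. 1 \<le> norm (u j)) \<and> (\<forall>j\<le>N. norm (u j) \<le> 2)" for u :: "nat \<Rightarrow> complex"
  define v where "v l j = q (l ! j)" for l j
  \<comment> \<open>Inadmissible vectors are replaced by the all-ones vector, which satisfies both
    bounds.\<close>
  define a where "a k = (if ok (v (fst (p k))) then v (fst (p k)) else (\<lambda>_. 1))" for k
  have ok: "ok (a k)" for k
    by (auto simp: a_def ok_def)
  show thesis
  proof
    show "\<exists>j\<le>N. 1 \<le> norm (a k j)" for k using ok by (auto simp: ok_def)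
    show "norm (a k j) \<le> 2" if "j \<le> N" for k j using ok that by (auto simp: ok_def)
    fix c :: "nat \<Rightarrow> complex" assume c: "\<exists>j\<le>N. c j \<noteq> 0"
    define R where "R = Max ((\<lambda>j. norm (c j)) ` {..N})"
    have R_ge: "norm (c j) \<le> R" if "j \<le> N" for j
      unfolding R_def using that by (intro Max_ge) auto
    have "R \<in> (\<lambda>j. norm (c j)) ` {..N}"
      unfolding R_def by (intro Max_in) auto
    then obtain j0 where j0: "j0 \<le> N" "norm (c j0) = R" by auto
    have R: "R > 0"
    proof -
      obtain j where "j \<le> N" "c j \<noteq> 0" using c by auto
      then show ?thesis using R_ge[of j] by (meson less_le_trans zero_less_norm_iff)
    qed
    \<comment> \<open>The largest coordinate is scaled to norm 3/2, midway between the bounds, so an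
      error below 1/2 keeps the approximation admissible.\<close>
    define s where "s = 3 / (2 * R)"
    have s: "s > 0" using R by (simp add: s_def)
    have "\<exists>k\<ge>K. \<forall>j\<le>N. norm (a k j - of_real s * c j) < e" if e: "e > 0" for e K
    proof -
      define d where "d = min e (1/2)"
      have d: "d > 0" using e by (simp add: d_def)
      have "\<forall>j. \<exists>i. norm (q i - of_real s * c j) < d" using dense[OF d] by blast
      then obtain h where h: "\<And>j. norm (q (h j) - of_real s * c j) < d" by metis
      define l where "l = map h [0..<Suc N]"
      have near: "norm (v l j - of_real s * c j) < d" if "j \<le> N" for j
        using h[of j] that unfolding v_def l_def by (simp del: upt_Suc)
      have sc: "norm (of_real s * c j) = s * norm (c j)" for j
        using s by (simp add: norm_mult)
      have "norm (of_real s * c j0) = 3/2"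
        using R unfolding sc j0 by (simp add: s_def)
      moreover have "norm (of_real s * c j0) - norm (v l j0) \<le> norm (v l j0 - of_real s * c j0)"
        by (metis norm_minus_commute norm_triangle_ineq2)
      moreover have "norm (v l j0 - of_real s * c j0) < 1/2"
        using near[OF j0(1)] by (simp add: d_def)
      ultimately have "1 \<le> norm (v l j0)" by linarith
      moreover have "norm (v l j) \<le> 2" if "j \<le> N" for j
      proof -
        have "s * norm (c j) \<le> 3/2"
          using R_ge[OF that] R by (simp add: s_def field_simps)
        then show ?thesis
          using near[OF that] norm_triangle_ineq2[of "v l j" "of_real s * c j"] sc[of j]
          by (simp add: d_def)
      qed
      ultimately have okl: "ok (v l)" using j0(1) by (auto simp: ok_def)
      have "infinite (range (\<lambda>r::nat. to_nat (l, r)))"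
        by (intro range_inj_infinite) (auto simp: inj_def)
      then obtain r :: nat where r: "to_nat (l, r) \<ge> K"
        unfolding infinite_nat_iff_unbounded_le by blast
      have "a (to_nat (l, r)) = v l"
        using okl by (simp add: a_def p_def)
      moreover have "norm (v l j - of_real s * c j) < e" if "j \<le> N" for j
        using near[OF that] by (simp add: d_def)
      ultimately show ?thesis using r by (intro exI[of _ "to_nat (l, r)"]) simp
    qed
    then show "\<exists>s>0. \<forall>e>0. \<forall>K. \<exists>k\<ge>K. \<forall>j\<le>N. norm (a k j - of_real s * c j) < e"
      using s by blast
  qed
qed

lemma root_of_unity_distance:
  fixes z :: complex
  assumes "z ^ r = 1" "z \<noteq> 1" "r > 0"
  shows "2 \<le> real r * norm (z - 1)"
proof -
  have nz: "norm z \<le> 1"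
    using assms(1,3) by (metis norm_one norm_power norm_ge_zero power_eq_1_iff order_refl gr_implies_not0)
  \<comment> \<open>Compare \<open>r\<close> with the vanishing sum of all powers, using \<open>norm (z ^ i - 1) \<le> i * norm (z - 1)\<close>.\<close>
  have "(\<Sum>i<r. z ^ i) = 0"
    using assms by (simp add: geometric_sum)
  then have "of_nat r = - (\<Sum>i<r. z ^ i - 1)"
    by (simp add: sum_subtractf)
  then have "norm (of_nat r :: complex) = norm (\<Sum>i<r. z ^ i - 1)"
    by (metis norm_minus_cancel)
  then have "real r = norm (\<Sum>i<r. z ^ i - 1)"
    by simp
  also have "\<dots> \<le> (\<Sum>i<r. real i * norm (z - 1))"
    using norm_power_diff[OF nz, of 1] by (intro sum_norm_le) simp
  also have "\<dots> = (\<Sum>i<r. real i) * norm (z - 1)"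
    by (simp add: sum_distrib_right)
  also have "(\<Sum>i<r. real i) = real r * (real r - 1) / 2"
    by (induction r) (auto simp: field_simps)
  finally have "real r * 2 \<le> real r * ((real r - 1) * norm (z - 1))"
    by (simp add: algebra_simps)
  then have "2 \<le> (real r - 1) * norm (z - 1)"
    using assms(3) by simp
  also have "\<dots> \<le> real r * norm (z - 1)"
    by (intro mult_right_mono) auto
  finally show ?thesis .
qed

lemma norm_cis_minus_one_le: "norm (cis t - 1) \<le> \<bar>t\<bar>"
  using dist_exp_i_1[of t] abs_sin_x_le_abs_x[of "t / 2"] by (simp add: cis_conv_exp)

section \<open>Biorthogonal blocks\<close>

text \<open>Real and complex scalars are treated together: \<open>\<Phi> = id\<close>, \<open>\<phi> = 1\<close> in the real case, and
  \<open>\<Phi> = J\<close>, \<open>\<phi> = \<i>\<close> in the complex case; \<open>A\<close>, \<open>B\<close>, \<open>H\<close> are only real-linear by themselves.\<close>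

definition block ::
  "('a::real_normed_vector \<Rightarrow> 'a) \<Rightarrow> complex \<Rightarrow> ('a \<Rightarrow> complex) \<Rightarrow> (complex \<Rightarrow> 'a) \<Rightarrow> bool" where
  "block \<Phi> \<phi> H B \<longleftrightarrow> bounded_linear H \<and> bounded_linear B \<and> (\<forall>z. H (B z) = z) \<and>
     (\<forall>x. norm (H x) \<le> 3 * norm x) \<and> (\<forall>z. norm (B z) \<le> 2 * norm z) \<and>
     (\<forall>x. H (\<Phi> x) = \<phi> * H x) \<and> (\<forall>z. B (\<phi> * z) = \<Phi> (B z))"

lemma abs_Re_plus_abs_Im_le: "\<bar>Re z\<bar> + \<bar>Im z\<bar> \<le> 2 * norm z"
  using abs_Re_le_cmod[of z] abs_Im_le_cmod[of z] by linarith

lemma bounded_linear_real_combination: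
  fixes e e' :: "'a::real_normed_vector"
  assumes "norm e = 1" "norm e' = 1"
  shows "norm (Re z *\<^sub>R e + Im z *\<^sub>R e') \<le> 2 * norm z"
    "bounded_linear (\<lambda>z. Re z *\<^sub>R e + Im z *\<^sub>R e')"
proof -
  show le: "norm (Re z *\<^sub>R e + Im z *\<^sub>R e') \<le> 2 * norm z" for z
    using norm_triangle_ineq[of "Re z *\<^sub>R e" "Im z *\<^sub>R e'"] abs_Re_plus_abs_Im_le[of z] assms by simp
  show "bounded_linear (\<lambda>z. Re z *\<^sub>R e + Im z *\<^sub>R e')"
    by (rule bounded_linear_intro[where K = 2]) (use le in \<open>auto simp: algebra_simps\<close>)
qed

section \<open>A single block in the kernel of given functionals\<close>

lemma ex_unit_in_complex_kernels:
  fixes L :: "('a::real_normed_vector \<Rightarrow> complex) set" and F :: "('a \<Rightarrow> real) set"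
  assumes "infinite_dimensional TYPE('a)" "finite L" "\<And>l. l \<in> L \<Longrightarrow> bounded_linear l"
    "finite F" "\<And>f. f \<in> F \<Longrightarrow> bounded_linear f"
  obtains e :: 'a where "norm e = 1" "\<And>l. l \<in> L \<Longrightarrow> l e = 0" "\<And>f. f \<in> F \<Longrightarrow> f e = 0"
proof -
  let ?F = "F \<union> (\<lambda>l x. Re (l x)) ` L \<union> (\<lambda>l x. Im (l x)) ` L"
  have "linear f" if "f \<in> ?F" for f
    using that assms(3,5)
    by (auto intro!: bounded_linear.linear bounded_linear_compose[OF bounded_linear_Re]
        bounded_linear_compose[OF bounded_linear_Im])
  then obtain e :: 'a where e: "norm e = 1" "\<And>f. f \<in> ?F \<Longrightarrow> f e = 0"
    using ex_unit_in_kernels[of ?F] assms(1,2,4) by blast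
  show thesis
  proof
    show "l e = 0" if "l \<in> L" for l
      using e(2)[of "\<lambda>x. Re (l x)"] e(2)[of "\<lambda>x. Im (l x)"] that by (auto intro: complex_eqI)
  qed (use e in auto)
qed

text \<open>The block is the plane of unit vectors \<open>e\<close> and \<open>e'\<close> in the
  common kernel, where \<open>e'\<close> also lies in the kernel of the functional \<open>h\<close>
  norming \<open>e\<close>. The matrix of \<open>h\<close>, \<open>h'\<close> on this plane is then
  unitriangular; subtracting \<open>h' e * h x\<close> inverts it, and
  \<open>\<bar>h' e\<bar> \<le> 1\<close> yields the constant 3.\<close>

lemma ex_real_block:
  fixes L :: "('a::real_normed_vector \<Rightarrow> complex) set"
  assumes inf: "infinite_dimensional TYPE('a)" and L: "finite L" "\<And>l. l \<in> L \<Longrightarrow> bounded_linear l"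
  shows "\<exists>H B. block (\<lambda>x. x) 1 H B \<and> (\<forall>l\<in>L. \<forall>z. l (B z) = 0)"
proof -
  obtain e :: 'a where e: "norm e = 1" "\<And>l. l \<in> L \<Longrightarrow> l e = 0"
    using ex_unit_in_complex_kernels[OF inf L, of "{}"] by auto
  obtain h where h: "bounded_linear h" "\<And>y. \<bar>h y\<bar> \<le> norm y" "h e = 1"
    using ex_norming_functional[OF e(1)] by metis
  obtain e' :: 'a where e': "norm e' = 1" "\<And>l. l \<in> L \<Longrightarrow> l e' = 0" "h e' = 0"
    using ex_unit_in_complex_kernels[OF inf L, of "{h}"] h by auto
  obtain h' where h': "bounded_linear h'" "\<And>y. \<bar>h' y\<bar> \<le> norm y" "h' e' = 1"
    using ex_norming_functional[OF e'(1)] by metis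
  interpret h: bounded_linear h by (rule h)
  interpret h': bounded_linear h' by (rule h')
  define H where "H x = Complex (h x) (h' x - h' e * h x)" for x
  define B where "B z = Re z *\<^sub>R e + Im z *\<^sub>R e'" for z
  have H_le: "norm (H x) \<le> 3 * norm x" for x
  proof -
    have "\<bar>h' e * h x\<bar> \<le> 1 * norm x"
      unfolding abs_mult using h'(2)[of e] e h(2)[of x] by (intro mult_mono) auto
    then have "\<bar>Re (H x)\<bar> + \<bar>Im (H x)\<bar> \<le> 3 * norm x"
      using h(2)[of x] h'(2)[of x] unfolding H_def by simp
    then show ?thesis using cmod_le[of "H x"] by linarith
  qed
  have "bounded_linear H"
  proof (rule bounded_linear_intro[where K = 3])
    show "norm (H x) \<le> norm x * 3" for x using H_le[of x] by simp
  qed (auto simp: H_def h.add h'.add h.scaleR h'.scaleR algebra_simps complex_eq_iff)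
  moreover have "H (B z) = z" for z
    using h(3) h'(3) e'(3)
    by (auto simp: H_def B_def h.add h'.add h.scaleR h'.scaleR complex_eq_iff)
  moreover have "l (B z) = 0" if "l \<in> L" for l z
  proof -
    interpret l: bounded_linear l using L that by auto
    show ?thesis by (simp add: B_def l.add l.scaleR e(2)[OF that] e'(2)[OF that])
  qed
  ultimately have "block (\<lambda>x. x) 1 H B"
    using H_le bounded_linear_real_combination[OF e(1) e'(1)] unfolding block_def B_def[abs_def] by auto
  then show ?thesis using \<open>\<And>l z. l \<in> L \<Longrightarrow> l (B z) = 0\<close> by blast
qed

text \<open>The block is the complex line through \<open>e\<close>. For a real functional
  \<open>h\<close>, the map sending \<open>x\<close> to \<open>h x - \<i> * h (J x)\<close> is
  complex-linear for \<open>J\<close>; its value \<open>w\<close> at \<open>e\<close> has real part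
  1, so dividing by \<open>w\<close> does not increase the norm.\<close>

lemma ex_complex_block:
  fixes L :: "('a::real_normed_vector \<Rightarrow> complex) set"
  assumes inf: "infinite_dimensional TYPE('a)" and J: "complex_structure J"
    and L: "finite L" "\<And>l. l \<in> L \<Longrightarrow> bounded_linear l" "\<And>l x. l \<in> L \<Longrightarrow> l (J x) = \<i> * l x"
  shows "\<exists>H B. block J \<i> H B \<and> (\<forall>l\<in>L. \<forall>z. l (B z) = 0)"
proof -
  have JJ: "J (J x) = - x" for x using J by (simp add: complex_structure_def)
  have norm_J: "norm (J x) = norm x" for x
    using J[unfolded complex_structure_def, THEN conjunct2, THEN conjunct2, rule_format, of "pi / 2" x]
    by simp
  interpret J: bounded_linear J using J by (simp add: complex_structure_def)
  obtain e :: 'a where e: "norm e = 1" "\<And>l. l \<in> L \<Longrightarrow> l e = 0"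
    using ex_unit_in_complex_kernels[OF inf L(1,2), of "{}"] by auto
  obtain h where h: "bounded_linear h" "\<And>y. \<bar>h y\<bar> \<le> norm y" "h e = 1"
    using ex_norming_functional[OF e(1)] by metis
  interpret h: bounded_linear h by (rule h)
  define w where "w = Complex 1 (- h (J e))"
  define H where "H x = Complex (h x) (- h (J x)) / w" for x
  define B where "B z = Re z *\<^sub>R e + Im z *\<^sub>R J e" for z
  have w: "norm w \<ge> 1" using abs_Re_le_cmod[of w] by (simp add: w_def)
  then have w0: "w \<noteq> 0" by auto
  have H_le: "norm (H x) \<le> 3 * norm x" for x
  proof -
    have "norm (Complex (h x) (- h (J x))) \<le> 3 * norm x"
      using cmod_le[of "Complex (h x) (- h (J x))"] h(2)[of x] h(2)[of "J x"] norm_J[of x] by simp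
    moreover have "norm (H x) \<le> norm (Complex (h x) (- h (J x))) / 1"
      unfolding H_def norm_divide using w by (intro divide_left_mono) auto
    ultimately show ?thesis by simp
  qed
  have H_add: "H (x + y) = H x + H y" for x y
  proof -
    have "Complex (h (x + y)) (- h (J (x + y))) = Complex (h x) (- h (J x)) + Complex (h y) (- h (J y))"
      by (simp add: h.add J.add complex_eq_iff)
    then show ?thesis by (simp only: H_def add_divide_distrib)
  qed
  have H_scaleR: "H (c *\<^sub>R x) = c *\<^sub>R H x" for c x
  proof -
    have "Complex (h (c *\<^sub>R x)) (- h (J (c *\<^sub>R x))) = of_real c * Complex (h x) (- h (J x))"
      by (simp add: h.scaleR J.scaleR complex_eq_iff)
    then show ?thesis by (simp add: H_def scaleR_conv_of_real)
  qed
  have H_J: "H (J x) = \<i> * H x" for x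
  proof -
    have "Complex (h (J x)) (- h (J (J x))) = \<i> * Complex (h x) (- h (J x))"
      by (simp add: JJ h.neg complex_eq_iff)
    then show ?thesis by (simp add: H_def)
  qed
  have H_e: "H e = 1" using w0 h(3) by (simp add: H_def w_def)
  have "bounded_linear H"
  proof (rule bounded_linear_intro[where K = 3])
    show "norm (H x) \<le> norm x * 3" for x using H_le[of x] by simp
  qed (auto simp: H_add H_scaleR)
  moreover have "H (B z) = z" for z
    by (simp add: B_def H_add H_scaleR H_J H_e complex_eq_iff)
  moreover have "B (\<i> * z) = J (B z)" for z
    by (simp add: B_def J.add J.scaleR JJ)
  moreover have "bounded_linear B" "norm (B z) \<le> 2 * norm z" for z
    using bounded_linear_real_combination[OF e(1), of "J e"] e(1) unfolding B_def[abs_def]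
    by (auto simp: norm_J)
  ultimately have "block J \<i> H B"
    using H_le H_J unfolding block_def by auto
  moreover have "l (B z) = 0" if "l \<in> L" for l z
  proof -
    interpret l: bounded_linear l using L that by auto
    show ?thesis by (simp add: B_def l.add l.scaleR e(2)[OF that] L(3)[OF that])
  qed
  ultimately show ?thesis by blast
qed

section \<open>The sequence of blocks and its biorthogonalisation\<close>

locale block_sequence =
  fixes \<Phi> :: "'a::banach \<Rightarrow> 'a" and \<phi> :: complex
    and H :: "nat \<Rightarrow> 'a \<Rightarrow> complex" and B :: "nat \<Rightarrow> complex \<Rightarrow> 'a"
  assumes block: "block \<Phi> \<phi> (H k) (B k)"
    and H_B_less: "k < l \<Longrightarrow> H k (B l z) = 0"
    and \<Phi>: "bounded_linear \<Phi>"

text \<open>Dependent choice: each block is taken in the common kernel of all earlier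
  \<open>H j\<close>, which the definition of \<open>block\<close> makes eligible for
  \<open>step\<close>.\<close>

lemma ex_block_sequence:
  fixes \<Phi> :: "'a::banach \<Rightarrow> 'a"
  assumes step: "\<And>L. finite L \<Longrightarrow> (\<And>l. l \<in> L \<Longrightarrow> bounded_linear l) \<Longrightarrow>
      (\<And>l x. l \<in> L \<Longrightarrow> l (\<Phi> x) = \<phi> * l x) \<Longrightarrow>
      \<exists>H B. block \<Phi> \<phi> H B \<and> (\<forall>l\<in>L. \<forall>z. l (B z) = 0)"
    and \<Phi>: "bounded_linear \<Phi>"
  obtains H B where "block_sequence \<Phi> \<phi> H B"
proof -
  have "\<exists>f :: nat \<Rightarrow> ('a \<Rightarrow> complex) \<times> (complex \<Rightarrow> 'a).
      \<forall>n. block \<Phi> \<phi> (fst (f n)) (snd (f n)) \<and> (\<forall>j<n. \<forall>z. fst (f j) (snd (f n) z) = 0)"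
  proof (rule dependent_wf_choice[OF wf_less_than], goal_cases)
    case 1
    then show ?case by auto
  next
    case (2 n f)
    have "\<exists>H B. block \<Phi> \<phi> H B \<and> (\<forall>l\<in>(\<lambda>j. fst (f j)) ` {..<n}. \<forall>z. l (B z) = 0)"
      using 2 by (intro step) (auto simp: block_def)
    then show ?case by auto
  qed
  then obtain f :: "nat \<Rightarrow> ('a \<Rightarrow> complex) \<times> (complex \<Rightarrow> 'a)"
    where "\<And>n. block \<Phi> \<phi> (fst (f n)) (snd (f n))"
      "\<And>j n z. j < n \<Longrightarrow> fst (f j) (snd (f n) z) = 0" by blast
  then show thesis
    using \<Phi> by (intro that[of "\<lambda>n. fst (f n)" "\<lambda>n. snd (f n)"] block_sequence.intro) auto
qed

context block_sequence
begin

lemma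
  shows bounded_linear_H: "bounded_linear (H k)" and bounded_linear_B: "bounded_linear (B k)"
    and H_B: "H k (B k z) = z"
    and norm_H: "norm (H k x) \<le> 3 * norm x" and norm_B: "norm (B k z) \<le> 2 * norm z"
    and H_\<Phi>: "H k (\<Phi> x) = \<phi> * H k x" and B_\<Phi>: "B k (\<phi> * z) = \<Phi> (B k z)"
  using block[of k] by (auto simp: block_def)

sublocale H: bounded_linear "H k" for k by (rule bounded_linear_H)
sublocale B: bounded_linear "B k" for k by (rule bounded_linear_B)

text \<open>Gram--Schmidt makes the triangular system \<open>H\<close>, \<open>B\<close> biorthogonal, at the price of losing
  the uniform norm bound of \<open>H\<close>.\<close>

fun A :: "nat \<Rightarrow> 'a \<Rightarrow> complex" where
  "A n x = H n x - (\<Sum>j<n. H n (B j (A j x)))"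

declare A.simps [simp del]

lemma bounded_linear_A: "bounded_linear (A n)"
proof (induction n rule: less_induct)
  case (less n)
  have "bounded_linear (\<lambda>x. H n x - (\<Sum>j<n. H n (B j (A j x))))"
    by (intro bounded_linear_sub bounded_linear_sum bounded_linear_H less
        bounded_linear_compose[OF bounded_linear_H] bounded_linear_compose[OF bounded_linear_B]) auto
  moreover have "A n = (\<lambda>x. H n x - (\<Sum>j<n. H n (B j (A j x))))"
    by (rule ext) (rule A.simps)
  ultimately show ?case by metis
qed

sublocale A: bounded_linear "A k" for k by (rule bounded_linear_A)

lemma A_\<Phi>: "A n (\<Phi> x) = \<phi> * A n x"
proof (induction n rule: less_induct)
  case (less n)
  then show ?case
    by (simp add: A.simps[of n] H_\<Phi> B_\<Phi> right_diff_distrib sum_distrib_left)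
qed

text \<open>For \<open>l < n\<close> the only surviving correction term is
  \<open>H n (B l z)\<close>, which cancels the leading term; for \<open>l \<ge> n\<close> there is
  no correction and the triangular relations decide.\<close>

lemma A_B: "A n (B l z) = (if l = n then z else 0)"
proof (induction n rule: less_induct)
  case (less n)
  have "(\<Sum>j<n. H n (B j (A j (B l z)))) = (\<Sum>j<n. if j = l then H n (B j z) else 0)"
    using less by (intro sum.cong) (auto simp: B.zero H.zero)
  then show ?case
    by (simp add: A.simps[of n] H_B H_B_less)
qed

end

section \<open>The operator\<close>

locale rotation_system = block_sequence +
  fixes N :: nat and a :: "nat \<Rightarrow> nat \<Rightarrow> complex"
  assumes a_ge: "\<exists>j\<le>N. 1 \<le> norm (a k j)"
    and a_le: "j \<le> N \<Longrightarrow> norm (a k j) \<le> 2"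
    and a_dense: "\<exists>j\<le>N. c j \<noteq> 0 \<Longrightarrow>
      \<exists>s>0. \<forall>e>0. \<forall>K. \<exists>k\<ge>K. \<forall>j\<le>N. norm (a k j - of_real s * c j) < e"
begin

section \<open>Parameters and norm estimates\<close>

text \<open>The power of 4 gives geometric decay; the other factor absorbs the norms of the
  \<open>A k\<close>, for which no uniform bound is available.\<close>

definition r :: "nat \<Rightarrow> nat" where
  "r k = 4 ^ Suc k * (nat \<lceil>onorm (A (Suc N + k))\<rceil> + 1)"

definition m :: "nat \<Rightarrow> nat" where
  "m k = (\<Prod>i<k. r i)"

text \<open>The shift in the index matters: after \<open>m k\<close> steps rotation \<open>k\<close>
  has made only the fraction \<open>1 / r k\<close> of a turn, whereas all earlier ones have
  completed full turns.\<close>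

definition \<omega> :: "nat \<Rightarrow> complex" where
  "\<omega> k = cis (2 * pi / m (Suc k))"

definition g :: "nat \<Rightarrow> 'a \<Rightarrow> complex" where
  "g k x = (\<Sum>j\<le>N. a k j * A j x)"

text \<open>A bound for the norms of all \<open>g k\<close>, uniform in \<open>k\<close>.\<close>

definition G :: real where
  "G = (\<Sum>j\<le>N. 2 * onorm (A j))"

definition w :: "nat \<Rightarrow> 'a \<Rightarrow> complex" where
  "w k x = (\<omega> k - 1) * A (Suc N + k) x + g k x / of_nat (m k)"

definition T :: "'a \<Rightarrow> 'a" where
  "T x = x + (\<Sum>k. B (Suc N + k) (w k x))"

lemma norm_A_le: "norm (A k x) \<le> onorm (A k) * norm x"
  by (rule onorm) (rule bounded_linear_A)

lemma onorm_A_nonneg: "0 \<le> onorm (A k)"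
  by (rule onorm_pos_le) (rule bounded_linear_A)

lemma r_ge: "4 ^ Suc k * (onorm (A (Suc N + k)) + 1) \<le> real (r k)"
proof -
  have "onorm (A (Suc N + k)) + 1 \<le> real (nat \<lceil>onorm (A (Suc N + k))\<rceil> + 1)"
    using of_nat_ceiling[of "onorm (A (Suc N + k))"] by simp
  then have "4 ^ Suc k * (onorm (A (Suc N + k)) + 1) \<le> 4 ^ Suc k * real (nat \<lceil>onorm (A (Suc N + k))\<rceil> + 1)"
    by (intro mult_left_mono) auto
  also have "\<dots> = real (r k)"
    unfolding r_def of_nat_mult of_nat_power by simp
  finally show ?thesis .
qed

lemma onorm_le_r: "onorm (A (Suc N + k)) \<le> real (r k)"
proof -
  have "1 * (onorm (A (Suc N + k)) + 1) \<le> 4 ^ Suc k * (onorm (A (Suc N + k)) + 1)"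
    using onorm_A_nonneg[of "Suc N + k"] by (intro mult_right_mono one_le_power) auto
  also note r_ge
  finally show ?thesis by simp
qed

lemma pow_le_r: "4 ^ Suc k \<le> real (r k)"
proof -
  have "4 ^ Suc k * 1 \<le> 4 ^ Suc k * (onorm (A (Suc N + k)) + 1)"
    using onorm_A_nonneg[of "Suc N + k"] by (intro mult_left_mono) auto
  also note r_ge
  finally show ?thesis by simp
qed

lemma r_gt_1: "r k > 1"
proof -
  have "(1::nat) < 4 ^ Suc k"
    by (rule one_less_power) auto
  also have "\<dots> \<le> r k"
    by (simp add: r_def)
  finally show ?thesis .
qed

lemma m_0: "m 0 = 1" and m_Suc: "m (Suc k) = m k * r k"
  by (simp_all add: m_def)

lemma m_pos: "m k > 0"
  unfolding m_def using r_gt_1 by (intro prod_pos) (meson less_trans zero_less_one)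

lemma m_dvd: "k \<le> l \<Longrightarrow> m k dvd m l"
  by (induction l rule: dec_induct) (auto simp: m_Suc)

lemma m_gt: "k < m k"
proof (induction k)
  case 0
  then show ?case by (simp add: m_0)
next
  case (Suc k)
  then have "Suc k < m k + m k" by linarith
  also have "\<dots> \<le> m k * r k"
    using r_gt_1[of k] mult_le_mono2[of 2 "r k" "m k"] by linarith
  finally show ?case by (simp add: m_Suc)
qed

lemma m_Suc_ge: "K \<le> k \<Longrightarrow> real (m K) * real (r k) \<le> real (m (Suc k))"
  using dvd_imp_le[OF m_dvd[of K k] m_pos] by (simp add: m_Suc mult_right_mono)

lemma norm_\<omega>: "norm (\<omega> k) = 1"
  by (simp add: \<omega>_def)

lemma \<omega>_power_eq_1_iff: "\<omega> k ^ n = 1 \<longleftrightarrow> m (Suc k) dvd n"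
proof -
  have "\<i> * of_real (real n * (2 * pi / m (Suc k))) = 2 * of_real pi * \<i> * of_nat n / of_nat (m (Suc k))"
    by simp
  moreover have "\<omega> k ^ n = exp (\<i> * of_real (real n * (2 * pi / m (Suc k))))"
    unfolding \<omega>_def Complex.DeMoivre by (rule cis_conv_exp)
  ultimately have "\<omega> k ^ n = exp (2 * of_real pi * \<i> * of_nat n / of_nat (m (Suc k)))"
    by (simp only:)
  then show ?thesis
    using complex_root_unity_eq_1[of "m (Suc k)" n] m_pos[of "Suc k"] by simp
qed

lemma \<omega>_neq_1: "\<omega> k \<noteq> 1"
  using \<omega>_power_eq_1_iff[of k 1] m_gt[of "Suc k"] by auto

lemma norm_\<omega>_minus_1_le: "norm (\<omega> k - 1) \<le> 2 * pi / m (Suc k)"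
  unfolding \<omega>_def using norm_cis_minus_one_le[of "2 * pi / m (Suc k)"] by simp

text \<open>Since \<open>m (Suc k)\<close> is at least \<open>m K * r k\<close>, the angle is at
  most \<open>2 * pi / r k\<close>, and \<open>r k\<close> outweighs \<open>4 ^ Suc k\<close> times
  the norm of the coordinate. Used for one step (\<open>K = 0\<close>) and for \<open>m K\<close>
  steps.\<close>

lemma norm_rotation_term_le:
  assumes "K \<le> k" "n \<le> m K"
  shows "norm (\<omega> k ^ n - 1) * norm (A (Suc N + k) x) \<le> 4 * norm x * (1/4) ^ k"
proof -
  let ?\<alpha> = "onorm (A (Suc N + k))"
  have "norm (\<omega> k ^ n - 1) \<le> real n * norm (\<omega> k - 1)"
    using norm_power_diff[of "\<omega> k" 1 n] by (simp add: norm_\<omega>)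
  also have "\<dots> \<le> real (m K) * (2 * pi / m (Suc k))"
    using assms(2) norm_\<omega>_minus_1_le by (intro mult_mono) auto
  also have "\<dots> \<le> real (m K) * (2 * pi / (real (m K) * real (r k)))"
    using m_Suc_ge[OF assms(1)] m_pos r_gt_1[of k] by (intro mult_left_mono divide_left_mono) auto
  also have "\<dots> = 2 * pi / real (r k)"
    using m_pos[of K] by simp
  also have "\<dots> \<le> 8 / real (r k)"
    using pi_less_4 by (intro divide_right_mono) auto
  finally have "norm (\<omega> k ^ n - 1) * norm (A (Suc N + k) x) \<le> 8 / real (r k) * (?\<alpha> * norm x)"
    using norm_A_le by (intro mult_mono) auto
  also have "8 / real (r k) * (?\<alpha> * norm x) = 8 * norm x * (?\<alpha> / real (r k))"
    by simp
  also have "?\<alpha> / real (r k) \<le> 1 / 4 ^ Suc k"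
  proof -
    have "4 ^ Suc k * ?\<alpha> \<le> 4 ^ Suc k * (?\<alpha> + 1)" by simp
    also note r_ge
    finally show ?thesis using r_gt_1[of k] by (simp add: field_simps)
  qed
  also have "8 * norm x * (1 / 4 ^ Suc k) \<le> 4 * norm x * (1/4) ^ k"
    by (simp add: power_one_over field_simps)
  finally show ?thesis by (simp add: mult_left_mono)
qed

lemma G_nonneg: "0 \<le> G"
  unfolding G_def using onorm_A_nonneg by (intro sum_nonneg) auto

lemma norm_g_le: "norm (g k x) \<le> G * norm x"
proof -
  have "norm (g k x) \<le> (\<Sum>j\<le>N. 2 * onorm (A j) * norm x)"
    unfolding g_def
  proof (rule sum_norm_le)
    fix j assume "j \<in> {..N}"
    then have "norm (a k j) * norm (A j x) \<le> 2 * (onorm (A j) * norm x)"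
      using a_le norm_A_le by (intro mult_mono) auto
    then show "norm (a k j * A j x) \<le> 2 * onorm (A j) * norm x"
      by (simp add: norm_mult)
  qed
  then show ?thesis by (simp add: G_def sum_distrib_right)
qed

lemma g_add: "g k (x + y) = g k x + g k y"
  by (simp add: g_def A.add distrib_left sum.distrib)

lemma g_scaleR: "g k (c *\<^sub>R x) = c *\<^sub>R g k x"
  by (simp add: g_def A.scaleR scaleR_sum_right)

lemma g_\<Phi>: "g k (\<Phi> x) = \<phi> * g k x"
  by (simp add: g_def A_\<Phi> sum_distrib_left mult_ac)

text \<open>For \<open>k > K\<close> the factor \<open>r (k - 1)\<close> alone makes
  \<open>m k\<close> at least \<open>m K * 4 ^ k\<close>. The index 0, where \<open>m 0 = 1\<close>,
  is included so that \<open>K = 0\<close> covers every \<open>k\<close>.\<close>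

lemma norm_coupling_le:
  assumes "k = 0 \<or> K < k" "n \<le> m K"
  shows "real n * norm (g k x) / real (m k) \<le> G * norm x * real (if k = 0 then m K else 1) * (1/4) ^ k"
proof (cases k)
  case 0
  then show ?thesis
    using mult_mono[OF norm_g_le[of 0 x], of "real n" "real (m K)"] assms(2) G_nonneg
    by (simp add: m_0 mult.commute[of "real n"])
next
  case (Suc l)
  then have l: "K \<le> l" using assms by auto
  have "real n * norm (g k x) / real (m k) \<le> real (m K) * (G * norm x) / (real (m K) * 4 ^ k)"
  proof (intro frac_le mult_mono)
    have "real (m K) * 4 ^ k \<le> real (m K) * real (r l)"
      using pow_le_r[of l] by (intro mult_left_mono) (auto simp: Suc)
    then show "real (m K) * 4 ^ k \<le> real (m k)"
      using m_Suc_ge[OF l] Suc by simp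
  qed (use assms(2) norm_g_le m_pos in \<open>auto intro!: mult_nonneg_nonneg G_nonneg\<close>)
  also have "\<dots> = G * norm x * (1/4) ^ k"
    using m_pos[of K] by (simp add: power_one_over field_simps)
  finally show ?thesis using Suc by simp
qed

lemma norm_w_le: "norm (w k x) \<le> (4 + G) * norm x * (1/4) ^ k"
proof -
  have "norm (w k x) \<le> norm (\<omega> k ^ 1 - 1) * norm (A (Suc N + k) x) + real 1 * norm (g k x) / real (m k)"
    unfolding w_def by (rule norm_triangle_le) (simp add: norm_mult norm_divide)
  also have "\<dots> \<le> 4 * norm x * (1/4) ^ k + G * norm x * real (if k = 0 then m 0 else 1) * (1/4) ^ k"
    by (intro add_mono norm_rotation_term_le[of 0] norm_coupling_le) (auto simp: m_0)
  also have "\<dots> = (4 + G) * norm x * (1/4) ^ k"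
    by (simp add: m_0 algebra_simps)
  finally show ?thesis .
qed

lemma norm_B_w_le: "norm (B l (w k x)) \<le> 2 * (4 + G) * norm x * (1/4) ^ k"
proof -
  have "norm (B l (w k x)) \<le> 2 * ((4 + G) * norm x * (1/4) ^ k)"
    using norm_B[of l "w k x"] norm_w_le[of k x] by linarith
  then show ?thesis by (simp only: mult.assoc)
qed

section \<open>Convergence, boundedness and linearity of the operator\<close>

lemma summable_B_w: "summable (\<lambda>k. B (Suc N + k) (w k x))"
  by (rule summable_comparison_test'[OF _ norm_B_w_le]) (intro summable_mult summable_geometric, simp)

lemma T_sums: "(\<lambda>k. B (Suc N + k) (w k x)) sums (T x - x)"
  using summable_sums[OF summable_B_w[of x]] by (simp add: T_def)

lemma bounded_linear_T: "bounded_linear T"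
proof (rule bounded_linear_intro)
  have w_add: "w k (x + y) = w k x + w k y" for k x y
    by (simp add: w_def g_add A.add distrib_left add_divide_distrib)
  have w_scaleR: "w k (c *\<^sub>R x) = c *\<^sub>R w k x" for k c x
    by (simp add: w_def g_scaleR A.scaleR scaleR_conv_of_real distrib_left mult.left_commute)
  show "T (x + y) = T x + T y" for x y
  proof -
    have "(\<Sum>k. B (Suc N + k) (w k (x + y))) = (\<Sum>k. B (Suc N + k) (w k x)) + (\<Sum>k. B (Suc N + k) (w k y))"
      unfolding w_add B.add by (rule suminf_add[OF summable_B_w summable_B_w, symmetric])
    then show ?thesis
      unfolding T_def by (simp only: add_ac)
  qed
  show "T (c *\<^sub>R x) = c *\<^sub>R T x" for c x
    unfolding T_def w_scaleR B.scaleR suminf_scaleR_right[OF summable_B_w, symmetric]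
    by (simp only: scaleR_add_right)
  show "norm (T x) \<le> norm x * (1 + 2 * (4 + G) * (\<Sum>k. (1/4) ^ k))" for x
  proof -
    have "norm (\<Sum>k. B (Suc N + k) (w k x)) \<le> (\<Sum>k. 2 * (4 + G) * norm x * (1/4) ^ k)"
      by (intro norm_suminf_le norm_B_w_le summable_mult summable_geometric) simp
    also have "\<dots> = 2 * (4 + G) * norm x * (\<Sum>k. (1/4) ^ k)"
      by (intro suminf_mult summable_geometric) simp
    finally show ?thesis
      unfolding T_def using norm_triangle_ineq[of x "\<Sum>k. B (Suc N + k) (w k x)"]
      by (simp add: algebra_simps)
  qed
qed

text \<open>For \<open>\<Phi> = J\<close> this is complex linearity of \<open>T\<close>.\<close>

lemma T_\<Phi>: "T (\<Phi> x) = \<Phi> (T x)"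
proof -
  interpret \<Phi>: bounded_linear \<Phi> by (rule \<Phi>)
  have "w k (\<Phi> x) = \<phi> * w k x" for k
    by (simp add: w_def g_\<Phi> A_\<Phi> distrib_left mult_ac)
  then show ?thesis
    unfolding T_def by (simp only: B_\<Phi> \<Phi>.add \<Phi>.suminf[OF summable_B_w])
qed

section \<open>Coordinates of the iterates\<close>

lemma A_T_base:
  assumes "i \<le> N"
  shows "A i (T x) = A i x"
proof -
  have "(\<lambda>k. A i (B (Suc N + k) (w k x))) sums A i (T x - x)"
    by (rule A.sums[OF T_sums])
  then have "(\<lambda>k. 0) sums A i (T x - x)"
    using assms by (simp add: A_B)
  then have "A i (T x - x) = 0"
    using sums_unique2 sums_zero by blast
  then show ?thesis by (simp add: A.diff)
qed

lemma A_T: "A (Suc N + i) (T x) = A (Suc N + i) x + w i x"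
proof -
  have "(\<lambda>k. A (Suc N + i) (B (Suc N + k) (w k x))) sums A (Suc N + i) (T x - x)"
    by (rule A.sums[OF T_sums])
  then have "(\<lambda>k. if k = i then w k x else 0) sums A (Suc N + i) (T x - x)"
    by (simp add: A_B)
  then have "A (Suc N + i) (T x - x) = w i x"
    using sums_unique2 sums_single[of i "\<lambda>k. w k x"] by blast
  then show ?thesis by (simp add: A.diff algebra_simps)
qed

lemma g_funpow: "g k ((T ^^ n) x) = g k x"
proof -
  have "A j ((T ^^ n) x) = A j x" if "j \<le> N" for j
    by (induction n) (auto simp: A_T_base[OF that])
  then show ?thesis by (simp add: g_def)
qed

text \<open>The displacement of rotating block \<open>k\<close> after \<open>n\<close> steps. As
  \<open>g k\<close> is invariant under \<open>T\<close>, each step is the same affine map of the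
  coordinate, and this solves the recursion.\<close>

definition u :: "nat \<Rightarrow> nat \<Rightarrow> 'a \<Rightarrow> complex" where
  "u k n x = (\<omega> k ^ n - 1) * A (Suc N + k) x + (\<Sum>l<n. \<omega> k ^ l) * g k x / of_nat (m k)"

lemma A_funpow: "A (Suc N + k) ((T ^^ n) x) = A (Suc N + k) x + u k n x"
proof (induction n)
  case 0
  then show ?case by (simp add: u_def)
next
  case (Suc n)
  define S q where "S = (\<Sum>l<n. \<omega> k ^ l)" and "q = g k x / of_nat (m k)"
  have "(\<Sum>l<Suc n. \<omega> k ^ l) = 1 + \<omega> k * S"
    unfolding S_def sum.lessThan_Suc_shift by (simp add: sum_distrib_left)
  then have u_Suc: "u k (Suc n) x = (\<omega> k ^ Suc n - 1) * A (Suc N + k) x + (1 + \<omega> k * S) * q"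
    by (simp add: u_def q_def)
  have u: "u k n x = (\<omega> k ^ n - 1) * A (Suc N + k) x + S * q"
    by (simp add: u_def S_def q_def)
  have "A (Suc N + k) ((T ^^ Suc n) x)
      = A (Suc N + k) ((T ^^ n) x) + ((\<omega> k - 1) * A (Suc N + k) ((T ^^ n) x) + q)"
    using A_T[of k "(T ^^ n) x"] by (simp add: w_def g_funpow q_def)
  then show ?case
    unfolding Suc u u_Suc by (simp add: algebra_simps)
qed

text \<open>The blocks are not assumed to form a basis; the expansion comes from adding up the
  series of the single steps.\<close>

lemma funpow_sums: "(\<lambda>k. B (Suc N + k) (u k n x)) sums ((T ^^ n) x - x)"
proof (induction n)
  case 0
  then show ?case by (simp add: u_def B.zero)
next
  case (Suc n)
  have "w k ((T ^^ n) x) + u k n x = u k (Suc n) x" for k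
    using A_T[of k "(T ^^ n) x"] A_funpow[of k n x] A_funpow[of k "Suc n" x]
    by (simp add: algebra_simps)
  then show ?case
    using sums_add[OF T_sums[of "(T ^^ n) x"] Suc] by (simp flip: B.add)
qed

text \<open>Then \<open>\<omega> k ^ n = 1\<close>, and the geometric sum over full periods
  vanishes.\<close>

lemma u_eq_0:
  assumes "m (Suc k) dvd n"
  shows "u k n x = 0"
  using assms \<omega>_neq_1[of k] by (simp add: u_def \<omega>_power_eq_1_iff[THEN iffD2] geometric_sum)

section \<open>Recurrence of all \<open>N\<close>-tuples along the times \<open>m K\<close>\<close>

text \<open>Blocks before \<open>K\<close> are back in place, block \<open>K\<close> may move by
  \<open>g K x\<close>, and later ones are small. Splitting \<open>(1/4) ^ k\<close> leaves one
  factor that tends to 0 with \<open>K\<close> and one that is summable over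
  \<open>k\<close>.\<close>

lemma norm_u_le:
  "norm (u k (m K) x) \<le> (1/2) ^ K * (4 + G) * norm x * (1/2) ^ k + (if k = K then norm (g K x) else 0)"
proof (cases "k < K")
  case True
  then show ?thesis
    using u_eq_0[OF m_dvd[of "Suc k" K], of x] G_nonneg by (simp add: Suc_le_eq)
next
  case False
  then have k: "K \<le> k" by simp
  have S: "norm (\<Sum>l<m K. \<omega> k ^ l) \<le> real (m K)"
    using sum_norm_le[of "{..<m K}" "\<lambda>l. \<omega> k ^ l" "\<lambda>_. 1"] by (simp add: norm_power norm_\<omega>)
  have "norm (u k (m K) x) \<le> norm (\<omega> k ^ m K - 1) * norm (A (Suc N + k) x)
      + norm (\<Sum>l<m K. \<omega> k ^ l) * norm (g k x) / real (m k)"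
    unfolding u_def by (rule norm_triangle_le) (simp add: norm_mult norm_divide)
  also have "\<dots> \<le> 4 * norm x * (1/4) ^ k + real (m K) * norm (g k x) / real (m k)"
    using S by (intro add_mono norm_rotation_term_le[OF k] divide_right_mono mult_right_mono) auto
  also have "real (m K) * norm (g k x) / real (m k) \<le> G * norm x * (1/4) ^ k + (if k = K then norm (g K x) else 0)"
  proof (cases "k = K")
    case True
    then show ?thesis using m_pos[of K] G_nonneg by simp
  next
    case False
    then show ?thesis using k norm_coupling_le[of k K "m K" x] by (auto split: if_splits)
  qed
  also have "4 * norm x * (1/4) ^ k + (G * norm x * (1/4) ^ k + (if k = K then norm (g K x) else 0))
      = (4 + G) * norm x * (1/4) ^ k + (if k = K then norm (g K x) else 0)"
    by (simp add: algebra_simps)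
  also have "(4 + G) * norm x * (1/4) ^ k \<le> (4 + G) * norm x * ((1/2) ^ K * (1/2) ^ k)"
  proof (rule mult_left_mono)
    have "(1/4 :: real) ^ k = (1/2) ^ k * (1/2) ^ k"
      by (simp flip: power_mult_distrib)
    also have "\<dots> \<le> (1/2) ^ K * (1/2) ^ k"
      using k by (intro mult_right_mono power_decreasing) auto
    finally show "(1/4 :: real) ^ k \<le> (1/2) ^ K * (1/2) ^ k" .
  qed (use G_nonneg in auto)
  finally show ?thesis by (simp add: mult_ac)
qed

lemma norm_funpow_diff_le:
  "norm ((T ^^ m K) x - x) \<le> 4 * (4 + G) * norm x * (1/2) ^ K + 2 * norm (g K x)"
proof -
  let ?b = "\<lambda>k. 2 * ((1/2) ^ K * (4 + G) * norm x) * (1/2) ^ k + (if k = K then 2 * norm (g K x) else 0)"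
  have b: "?b sums (2 * ((1/2) ^ K * (4 + G) * norm x) * (1 / (1 - 1/2)) + 2 * norm (g K x))"
    by (intro sums_add sums_mult geometric_sums sums_single) simp
  have "norm (B (Suc N + k) (u k (m K) x)) \<le> ?b k" for k
    using norm_B[of "Suc N + k" "u k (m K) x"] norm_u_le[of k K x] by (auto split: if_splits)
  then have "norm (\<Sum>k. B (Suc N + k) (u k (m K) x)) \<le> suminf ?b"
    using sums_summable[OF b] by (intro norm_suminf_le) auto
  also have "suminf ?b = 2 * ((1/2) ^ K * (4 + G) * norm x) * (1 / (1 - 1/2)) + 2 * norm (g K x)"
    by (rule sums_unique[OF b, symmetric])
  also have "\<dots> = 4 * (4 + G) * norm x * (1/2) ^ K + 2 * norm (g K x)"
    by (simp add: algebra_simps)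
  also have "(\<Sum>k. B (Suc N + k) (u k (m K) x)) = (T ^^ m K) x - x"
    using sums_unique[OF funpow_sums] by simp
  finally show ?thesis .
qed

lemma all_recurrent_sum_T: "all_recurrent_sum T N"
  unfolding all_recurrent_sum_def recurrent_vec_def
proof (intro allI impI)
  fix x :: "nat \<Rightarrow> 'a" and e :: real
  assume e: "e > 0"
  obtain b where b: "\<exists>j\<in>{..N}. b j \<noteq> 0"
    and b0: "\<And>i. i < N \<Longrightarrow> (\<Sum>j\<in>{..N}. b j * A j (x i)) = 0"
    using homogeneous_system_nontrivial[of "{..N}" N "\<lambda>i j. A j (x i)"] by auto
  obtain s where s: "\<And>e K. e > 0 \<Longrightarrow> \<exists>k\<ge>K. \<forall>j\<le>N. norm (a k j - of_real s * b j) < e"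
    using a_dense[of b] b by (auto simp: Bex_def)
  define X where "X = (\<Sum>i<N. norm (x i))"
  \<comment> \<open>The summand 1 keeps \<open>W\<close> positive, so that
    \<open>e / (4 * W)\<close> makes sense even if all coordinates vanish.\<close>
  define W where "W = 1 + (\<Sum>i<N. \<Sum>j\<le>N. norm (A j (x i)))"
  have W: "W > 0" unfolding W_def by (intro add_pos_nonneg sum_nonneg) auto
  have "(\<lambda>K. 4 * (4 + G) * X * (1/2) ^ K) \<longlonglongrightarrow> 4 * (4 + G) * X * 0"
    by (intro tendsto_mult tendsto_const LIMSEQ_power_zero) simp
  then have "eventually (\<lambda>K. 4 * (4 + G) * X * (1/2) ^ K < e / 2) sequentially"
    using e by (intro order_tendstoD(2)) auto
  then obtain K0 where K0: "\<And>K. K \<ge> K0 \<Longrightarrow> 4 * (4 + G) * X * (1/2) ^ K < e / 2"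
    unfolding eventually_sequentially by auto
  \<comment> \<open>This tolerance gives \<open>2 * norm (g k (x i)) \<le> e / 2\<close>; the other
    half of \<open>e\<close> is covered by \<open>k \<ge> K0\<close>.\<close>
  obtain k where k: "k \<ge> K0" "\<And>j. j \<le> N \<Longrightarrow> norm (a k j - of_real s * b j) < e / (4 * W)"
    using s[of "e / (4 * W)" K0] e W by auto
  have "dist ((T ^^ m k) (x i)) (x i) < e" if i: "i < N" for i
  proof -
    have "(\<Sum>j\<le>N. (a k j - of_real s * b j) * A j (x i))
        = g k (x i) - of_real s * (\<Sum>j\<le>N. b j * A j (x i))"
      by (simp add: g_def left_diff_distrib sum_subtractf sum_distrib_left mult.assoc)
    then have g: "g k (x i) = (\<Sum>j\<le>N. (a k j - of_real s * b j) * A j (x i))"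
      using b0[OF i] by simp
    have "norm (g k (x i)) \<le> (\<Sum>j\<le>N. e / (4 * W) * norm (A j (x i)))"
      unfolding g
    proof (rule sum_norm_le)
      fix j assume "j \<in> {..N}"
      then show "norm ((a k j - of_real s * b j) * A j (x i)) \<le> e / (4 * W) * norm (A j (x i))"
        unfolding norm_mult using k(2)[of j] by (intro mult_right_mono) auto
    qed
    also have "\<dots> = e / (4 * W) * (\<Sum>j\<le>N. norm (A j (x i)))"
      by (simp add: sum_distrib_left)
    also have "\<dots> \<le> e / (4 * W) * W"
    proof (rule mult_left_mono)
      have "(\<Sum>j\<le>N. norm (A j (x i))) \<le> (\<Sum>i<N. \<Sum>j\<le>N. norm (A j (x i)))"
        using i by (intro member_le_sum[where f = "\<lambda>i. \<Sum>j\<le>N. norm (A j (x i))"] sum_nonneg) auto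
      then show "(\<Sum>j\<le>N. norm (A j (x i))) \<le> W" by (simp add: W_def)
    qed (use e W in auto)
    also have "\<dots> = e / 4" using W by simp
    finally have "2 * norm (g k (x i)) \<le> e / 2" by simp
    moreover have "4 * (4 + G) * norm (x i) * (1/2) ^ k \<le> 4 * (4 + G) * X * (1/2) ^ k"
      unfolding X_def using i G_nonneg
      by (intro mult_right_mono mult_left_mono member_le_sum[where f = "\<lambda>i. norm (x i)"]) auto
    ultimately show ?thesis
      using norm_funpow_diff_le[of k "x i"] K0[OF k(1)] by (simp add: dist_norm)
  qed
  then show "\<exists>n\<ge>1. \<forall>i<N. dist ((T ^^ n) (x i)) (x i) < e"
    using m_pos[of k] by (intro exI[of _ "m k"]) auto
qed

section \<open>Failure of recurrence for \<open>N + 1\<close> summands\<close>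

text \<open>On block \<open>k\<close>, \<open>T\<close> is a rotation about the fixed point
  \<open>- g k x / (m k * (\<omega> k - 1))\<close>, which lies at distance at least
  \<open>r k / 16\<close> from 0 and hence at least \<open>r k / 32\<close> from the coordinate. The
  displacement is that distance times \<open>norm (\<omega> k ^ n - 1)\<close>, which is at least
  \<open>2 / r k\<close>.\<close>

lemma norm_u_ge:
  assumes "m k dvd n" "\<not> m (Suc k) dvd n"
    and A: "norm (A (Suc N + k) x) \<le> real (r k) / 32" and g: "norm (g k x) \<ge> 1/2"
  shows "norm (u k n x) \<ge> 1/16"
proof -
  let ?z = "\<omega> k ^ n"
  have z: "?z \<noteq> 1" using assms by (simp add: \<omega>_power_eq_1_iff)
  \<comment> \<open>\<open>?z\<close> is a nontrivial \<open>r k\<close>-th root of unity, hence at distance at least \<open>2 / r k\<close> from 1.\<close>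
  have "?z ^ r k = \<omega> k ^ (n * r k)" by (simp add: power_mult)
  also have "\<dots> = 1" using assms(1) by (simp add: \<omega>_power_eq_1_iff m_Suc)
  finally have "2 \<le> real (r k) * norm (?z - 1)"
    using root_of_unity_distance z r_gt_1[of k] by (metis less_trans zero_less_one)
  then have z_ge: "2 / real (r k) \<le> norm (?z - 1)"
    using r_gt_1[of k] by (simp add: field_simps)
  have "real (r k) / 16 = (1/2) / (8 / real (r k))" by simp
  also have "\<dots> \<le> norm (g k x) / (real (m k) * norm (\<omega> k - 1))"
  proof (rule frac_le)
    have "real (m k) * norm (\<omega> k - 1) \<le> real (m k) * (8 / real (m (Suc k)))"
      using norm_\<omega>_minus_1_le[of k] pi_less_4 m_pos
      by (intro mult_left_mono order.trans[OF norm_\<omega>_minus_1_le] divide_right_mono) auto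
    then show "real (m k) * norm (\<omega> k - 1) \<le> 8 / real (r k)"
      using m_pos[of k] by (simp add: m_Suc)
    show "0 < real (m k) * norm (\<omega> k - 1)"
      using m_pos \<omega>_neq_1 by simp
  qed (use g in auto)
  also have "\<dots> = norm (g k x / (of_nat (m k) * (\<omega> k - 1)))"
    by (simp add: norm_mult norm_divide)
  finally have "real (r k) / 32 \<le> norm (g k x / (of_nat (m k) * (\<omega> k - 1))) - norm (A (Suc N + k) x)"
    using A by simp
  also have "\<dots> \<le> norm (g k x / (of_nat (m k) * (\<omega> k - 1)) + A (Suc N + k) x)"
    by (rule norm_diff_ineq)
  also have "\<dots> = norm (A (Suc N + k) x + g k x / (of_nat (m k) * (\<omega> k - 1)))"
    by (simp only: add.commute)
  finally have "2 / real (r k) * (real (r k) / 32)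
      \<le> norm (?z - 1) * norm (A (Suc N + k) x + g k x / (of_nat (m k) * (\<omega> k - 1)))"
    using z_ge by (intro mult_mono) auto
  also have "\<dots> = norm (u k n x)"
    using \<omega>_neq_1[of k] by (simp add: u_def geometric_sum distrib_left mult_ac flip: norm_mult)
  finally show ?thesis using r_gt_1[of k] by simp
qed

text \<open>Applying \<open>H (Suc N + k)\<close> to the series isolates block \<open>k\<close>:
  earlier blocks have returned and later ones are annihilated. Using \<open>H\<close> instead of
  \<open>A\<close> makes the constant 3 independent of \<open>k\<close>.\<close>

lemma norm_funpow_diff_ge:
  assumes "m k dvd n"
  shows "norm (u k n x) \<le> 3 * norm ((T ^^ n) x - x)"
proof -
  have "(\<lambda>l. H (Suc N + k) (B (Suc N + l) (u l n x))) sums H (Suc N + k) ((T ^^ n) x - x)"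
    by (rule H.sums[OF funpow_sums])
  moreover have "H (Suc N + k) (B (Suc N + l) (u l n x)) = (if l = k then u l n x else 0)" for l
  proof (cases "l < k")
    case True
    then have "m (Suc l) dvd n"
      using m_dvd[of "Suc l" k] assms dvd_trans by (simp add: Suc_le_eq)
    then show ?thesis
      using True by (simp add: u_eq_0 B.zero H.zero)
  next
    case False
    then show ?thesis by (auto simp: H_B H_B_less)
  qed
  ultimately have "(\<lambda>l. if l = k then u l n x else 0) sums H (Suc N + k) ((T ^^ n) x - x)"
    by simp
  then have "H (Suc N + k) ((T ^^ n) x - x) = u k n x"
    using sums_unique2 sums_single[of k "\<lambda>l. u l n x"] by blast
  then show ?thesis using norm_H by metis
qed

lemma not_recurrent_sum_T: "\<not> recurrent_sum T (N + 1)"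
proof
  assume rec: "recurrent_sum T (N + 1)"
  \<comment> \<open>Small enough that the perturbation \<open>d\<close> below changes
    \<open>g k\<close> by at most 1/2 and has rotating coordinate at most
    \<open>r k / 32\<close>.\<close>
  define \<epsilon> where "\<epsilon> = 1 / (32 + 2 * G)"
  have \<epsilon>: "\<epsilon> > 0" "\<epsilon> \<le> 1/32" "G * \<epsilon> \<le> 1/2"
    using G_nonneg by (auto simp: \<epsilon>_def field_simps)
  obtain y where y: "recurrent_vec T (N + 1) y" "\<forall>i<N + 1. dist (y i) (B i 1) < \<epsilon>"
    using rec[unfolded recurrent_sum_def, rule_format, OF \<epsilon>(1), of "\<lambda>i. B i 1"] by auto
  \<comment> \<open>The bound 1/48 is 1/16 divided by the constant 3 of
    \<open>norm_funpow_diff_ge\<close>.\<close>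
  obtain n where n: "n \<ge> 1" "\<And>i. i \<le> N \<Longrightarrow> dist ((T ^^ n) (y i)) (y i) < 1/48"
    using y(1)[unfolded recurrent_vec_def, rule_format, of "1/48"] by auto
  \<comment> \<open>As \<open>m 0 = 1\<close> divides \<open>n\<close> but \<open>m n > n\<close>
    does not, divisibility breaks off at some \<open>k\<close>.\<close>
  have "\<not> m n dvd n"
    using m_gt[of n] n(1) by (auto dest: dvd_imp_le)
  moreover have "m l dvd n" if "\<And>k. m k dvd n \<Longrightarrow> m (Suc k) dvd n" for l
    using that by (induction l) (auto simp: m_0)
  ultimately obtain k where k: "m k dvd n" "\<not> m (Suc k) dvd n"
    by blast
  \<comment> \<open>The coordinate depends on \<open>k\<close>, hence on \<open>n\<close>; this is
    why all \<open>N + 1\<close> vectors are needed.\<close>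
  obtain i where i: "i \<le> N" "1 \<le> norm (a k i)" using a_ge by auto
  define d where "d = y i - B i 1"
  have d: "norm d \<le> \<epsilon>" and yd: "y i = B i 1 + d"
    using y(2) i(1) by (auto simp: d_def dist_norm less_Suc_eq_le less_imp_le)
  have "g k (B i 1) = (\<Sum>j\<le>N. if i = j then a k j else 0)"
    unfolding g_def by (intro sum.cong) (auto simp: A_B)
  then have gi: "g k (B i 1) = a k i" using i by simp
  have "norm (g k d) \<le> 1/2"
    using norm_g_le[of k d] mult_left_mono[OF d G_nonneg] \<epsilon>(3) by linarith
  then have "norm (g k (y i)) \<ge> 1/2"
    using norm_diff_ineq[of "a k i" "g k d"] i(2) unfolding yd g_add gi by linarith
  moreover have "norm (A (Suc N + k) (y i)) \<le> real (r k) / 32"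
  proof -
    have "A (Suc N + k) (y i) = A (Suc N + k) d"
      using i(1) by (simp add: yd A.add A_B)
    also have "norm \<dots> \<le> real (r k) * (1/32)"
      using d \<epsilon>(2) by (intro order.trans[OF norm_A_le] mult_mono onorm_le_r) auto
    finally show ?thesis by simp
  qed
  ultimately have "1/16 \<le> norm (u k n (y i))"
    using k by (intro norm_u_ge)
  also have "\<dots> \<le> 3 * norm ((T ^^ n) (y i) - y i)"
    by (rule norm_funpow_diff_ge[OF k(1)])
  finally show False
    using n(2)[OF i(1)] by (simp add: dist_norm)
qed

end

section \<open>Existence in the real and the complex case\<close>

lemma (in block_sequence) ex_operator:
  "\<exists>T. bounded_linear T \<and> (\<forall>x. T (\<Phi> x) = \<Phi> (T x)) \<and> all_recurrent_sum T N \<and> \<not> recurrent_sum T (N + 1)"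
proof -
  obtain a :: "nat \<Rightarrow> nat \<Rightarrow> complex" where
    "\<And>k. \<exists>j\<le>N. 1 \<le> norm (a k j)" "\<And>k j. j \<le> N \<Longrightarrow> norm (a k j) \<le> 2"
    "\<And>c. (\<exists>j\<le>N. c j \<noteq> 0) \<Longrightarrow>
      \<exists>s>0. \<forall>e>0. \<forall>K. \<exists>k\<ge>K. \<forall>j\<le>N. norm (a k j - of_real s * c j) < e"
    using ex_dense_repeating_coefficients[of N] by blast
  then interpret rotation_system \<Phi> \<phi> H B N a
    by unfold_locales
  show ?thesis
    using bounded_linear_T T_\<Phi> all_recurrent_sum_T not_recurrent_sum_T by blast
qed

theorem mainTheorem8:
  fixes N :: nat and J :: "'a::banach \<Rightarrow> 'a"
  assumes "separable_space TYPE('a)" and "infinite_dimensional TYPE('a)"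
  shows "(\<exists>T::'a \<Rightarrow> 'a. bounded_linear T \<and> all_recurrent_sum T N \<and> \<not> recurrent_sum T (N + 1))
       \<and> (complex_structure J \<longrightarrow>
           (\<exists>T::'a \<Rightarrow> 'a. bounded_linear T \<and> (\<forall>x. T (J x) = J (T x)) \<and>
                all_recurrent_sum T N \<and> \<not> recurrent_sum T (N + 1)))"
proof (intro conjI impI)
  obtain H :: "nat \<Rightarrow> 'a \<Rightarrow> complex" and B where "block_sequence (\<lambda>x. x) 1 H B"
    by (rule ex_block_sequence[OF ex_real_block[OF assms(2)] bounded_linear_ident])
  then show "\<exists>T::'a \<Rightarrow> 'a. bounded_linear T \<and> all_recurrent_sum T N \<and> \<not> recurrent_sum T (N + 1)"
    using block_sequence.ex_operator[of "\<lambda>x. x" 1 H B N] by simp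
next
  assume J: "complex_structure J"
  then have bl: "bounded_linear J" by (simp add: complex_structure_def)
  obtain H B where "block_sequence J \<i> H B"
    by (rule ex_block_sequence[OF ex_complex_block[OF assms(2) J] bl])
  then show "\<exists>T::'a \<Rightarrow> 'a. bounded_linear T \<and> (\<forall>x. T (J x) = J (T x)) \<and>
      all_recurrent_sum T N \<and> \<not> recurrent_sum T (N + 1)"
    by (rule block_sequence.ex_operator)
qed

end
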